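(* Let $0<\delta<1$, $\bar\delta:=1-\delta$. Let $\mu^{(0)}$ be a Borel probability measure with support in $[-1,1]$, let $\mu^{(1)}$ be the invariant measure of the affine homogeneous iterated function system with contraction ratio $\delta$ and distribution of fixed points $\mu^{(0)}$, and let $\mu^{(2)}$ be the invariant measure of the affine homogeneous iterated function system with the same contraction ratio $\delta$ and distribution of fixed points $\mu^{(1)}$. Put $\Phi_j(y):=\log|\widehat{\mu^{(j)}}(y)|$ and $$\eta:=-\sup\{\Phi_0(\delta^{-1}\bar\delta^{2}t)+\Phi_1(\bar\delta t)\;:\;t\in[1,\delta^{-1}]\}.$$ Then: (i) if $\eta>\frac12\log(\delta^{-1})$, the measure $\mu^{(2)}$ is absolutely continuous with respect to Lebesgue measure with an $L^2$ density; (ii) if $\eta>\log(\delta^{-1})$, the density of $\mu^{(2)}$ is continuous.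
   Context: Let $0<\delta<1$, $\bar\delta:=1-\delta$, and let $\sigma$ be a Borel probability measure on $[-1,1]$. The affine homogeneous iterated function system with contraction ratio $\delta$ and distribution of fixed points $\sigma$ is the family of maps $\phi_{\delta,\beta}(x)=\delta(x-\beta)+\beta=\delta x+\bar\delta\beta$ of $[-1,1]$ into itself, with $\beta$ chosen at random with law $\sigma$. Its transfer operator on continuous functions on $[-1,1]$ is $(Tf)(x)=\int f(\delta x+\bar\delta\beta)\,d\sigma(\beta)$, and $T^*$ is the adjoint acting on Borel measures, $\int f\,d(T^*\mu)=\int Tf\,d\mu$. The invariant measure is the unique Borel probability measure $\mu$ on $[-1,1]$ with $T^*\mu=\mu$ (existence and uniqueness are known). The Fourier transform of a measure $\nu$ is $\hat\nu(y)=\int e^{-iyx}\,d\nu(x)$. Convention: $\log 0=-\infty$. *)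

theory Defs
  imports "HOL-Probability.Probability"
begin

text \<open>A Borel measure on the interval from -1 to 1 is represented by its extension by zero
  to a Borel measure on the whole real line.\<close>

definition borel_prob_on_interval :: "real measure \<Rightarrow> bool" where
  "borel_prob_on_interval \<nu> \<longleftrightarrow>
     sets \<nu> = sets borel \<and> prob_space \<nu> \<and> emeasure \<nu> (- {-1..1}) = 0"

definition ifs_map :: "real \<Rightarrow> real \<Rightarrow> real \<Rightarrow> real" where
  "ifs_map \<delta> \<beta> x = \<delta> * (x - \<beta>) + \<beta>"

text \<open>Test functions are total on the reals but only constrained on the interval, hence the set
  integrals: a Bochner integral over the whole line would be 0 for a function that is not
  measurable outside of the interval.\<close>

definition transfer_op :: "real \<Rightarrow> real measure \<Rightarrow> (real \<Rightarrow> real) \<Rightarrow> real \<Rightarrow> real" where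
  "transfer_op \<delta> \<sigma> f x = (LINT \<beta>:{-1..1}|\<sigma>. f (ifs_map \<delta> \<beta> x))"

text \<open>The graph of the adjoint of the transfer operator: \<open>\<nu>\<close> is the image of \<open>\<mu>\<close>.\<close>

definition transfer_adjoint :: "real \<Rightarrow> real measure \<Rightarrow> real measure \<Rightarrow> real measure \<Rightarrow> bool" where
  "transfer_adjoint \<delta> \<sigma> \<mu> \<nu> \<longleftrightarrow>
     (\<forall>f. continuous_on {-1..1} f \<longrightarrow>
        (LINT x:{-1..1}|\<nu>. f x) = (LINT x:{-1..1}|\<mu>. transfer_op \<delta> \<sigma> f x))"

definition invariant_measure :: "real \<Rightarrow> real measure \<Rightarrow> real measure \<Rightarrow> bool" where
  "invariant_measure \<delta> \<sigma> \<mu> \<longleftrightarrow> borel_prob_on_interval \<mu> \<and> transfer_adjoint \<delta> \<sigma> \<mu> \<mu>"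

text \<open>The library's characteristic function has the kernel \<open>exp (\<i> * t * x)\<close>,
  whence the change of sign.\<close>

definition fourier :: "real measure \<Rightarrow> real \<Rightarrow> complex" where
  "fourier \<nu> y = char \<nu> (- y)"

text \<open>The real logarithm of the library is total, so the value at a zero of the transform
  is set explicitly.\<close>

definition log_fourier :: "real measure \<Rightarrow> real \<Rightarrow> ereal" where
  "log_fourier \<nu> y = (if fourier \<nu> y = 0 then - \<infinity> else ereal (ln (cmod (fourier \<nu> y))))"

definition lebesgue_density :: "real measure \<Rightarrow> (real \<Rightarrow> real) \<Rightarrow> bool" where
  "lebesgue_density \<nu> f \<longleftrightarrow>
     f \<in> borel_measurable borel \<and> (\<forall>x. 0 \<le> f x) \<and> \<nu> = density lborel (\<lambda>x. ennreal (f x))"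

end

theory Submission
  imports Defs
begin

text \<open>The invariance of \<open>\<mu>1\<close> and \<open>\<mu>2\<close> says that their Fourier transforms \<open>\<psi>\<close> and \<open>\<omega>\<close> satisfy the
refinement equations \<open>\<psi> y = \<psi> (\<delta> y) \<phi> ((1 - \<delta>) y)\<close> and \<open>\<omega> y = \<omega> (\<delta> y) \<psi> ((1 - \<delta>) y)\<close>, where \<open>\<phi>\<close> is
the transform of \<open>\<mu>0\<close> (\<open>char_invariant_measure\<close>). Every \<open>y \<ge> 1\<close> is \<open>t / \<delta> ^ n\<close> with \<open>t\<close> between 1
and \<open>1 / \<delta>\<close>. Unfolding the second equation \<open>n\<close> times produces the factors
\<open>\<psi> ((1 - \<delta>) t / \<delta> ^ k)\<close> with \<open>1 \<le> k \<le> n\<close>, and unfolding the first one \<open>k\<close> times shows that each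
of them contains \<open>\<psi> ((1 - \<delta>) t)\<close> and \<open>\<phi> ((1 - \<delta>)\<^sup>2 t / \<delta>)\<close>, while the other factors have
modulus at most 1. The number \<open>\<eta>\<close> is minus the supremum over \<open>t\<close> of the logarithm of the modulus
of just these two factors, so \<open>\<bar>\<omega> y\<bar> \<le> exp (- n \<eta>)\<close> (\<open>two_step_refinement_geometric_decay\<close>).
In terms of \<open>y\<close> this is a decay like the power of \<open>y\<close> with exponent \<open>- \<eta> / ln (1 / \<delta>)\<close>. The two
thresholds for \<open>\<eta>\<close> say that this exponent is below \<open>- 1 / 2\<close>, respectively below \<open>- 1\<close>, which makes
\<open>\<omega>\<close> square integrable, respectively integrable.

It remains to pass from the transform to the measure, for an arbitrary probability measure \<open>M\<close> on the
real line. Both cases use the convolution of \<open>M\<close> with the centred normal law of small standard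
deviation \<open>s\<close>. Its density \<open>smoothing s\<close> is given by an explicit Fourier integral, its squared
\<open>L\<^sup>2\<close> norm is given by Parseval's identity (\<open>smoothing_parseval\<close>), and it converges
weakly to \<open>M\<close> as \<open>s\<close> tends to 0 (\<open>smoothing_weak_limit\<close>).

If the transform is square integrable, the \<open>L\<^sup>2\<close> norms stay below a constant, so in the limit the
integral of a continuous function \<open>g\<close> against \<open>M\<close> is bounded in terms of the \<open>L\<^sup>2\<close> norm of \<open>g\<close>
(\<open>char_square_test_function_bound\<close>). Applied to approximations of the indicator of an open set of
small length, this gives absolute continuity; applied to approximations of the density itself, cut off at
a large height, it gives an \<open>L\<^sup>2\<close> bound for the density
(\<open>char_square_integrable_imp_L2_density\<close>). If the transform is integrable, the smoothed densities
are uniformly bounded and converge pointwise to the inverse Fourier integral of the transform, which is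
continuous and must be the density (\<open>char_integrable_imp_continuous_density\<close>).\<close>

section \<open>Fourier representation of Gaussian convolutions\<close>

text \<open>Up to scaling, the normal density is its own Fourier transform: this is the known characteristic
function of the standard normal law after the substitution \<open>z = s t\<close>.\<close>
lemma normal_density_fourier_inversion:
  assumes "0 < s"
  shows "complex_of_real (normal_density u s x) =
    1 / (2 * pi) * (CLINT t|lborel. iexp (t * (u - x)) * complex_of_real (exp (- ((s * t)\<^sup>2) / 2)))"
proof -
  define \<tau> where "\<tau> = (u - x) / s"
  have "complex_of_real (exp (- (\<tau>\<^sup>2) / 2)) = char std_normal_distribution \<tau>"
    by (simp add: char_std_normal_distribution)
  also have "\<dots> = (CLINT z|lborel. std_normal_density z *\<^sub>R iexp (\<tau> * z))"
    unfolding char_def by (subst integral_density) auto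
  also have "\<dots> = \<bar>s\<bar> *\<^sub>R (CLINT t|lborel. std_normal_density (0 + s * t) *\<^sub>R iexp (\<tau> * (0 + s * t)))"
    using assms by (intro lborel_integral_real_affine) auto
  also have "\<dots> = s / sqrt (2 * pi) *
      (CLINT t|lborel. iexp (t * (u - x)) * complex_of_real (exp (- ((s * t)\<^sup>2) / 2)))"
  proof -
    have "std_normal_density (0 + s * t) *\<^sub>R iexp (\<tau> * (0 + s * t)) =
        complex_of_real (1 / sqrt (2 * pi)) * (iexp (t * (u - x)) * complex_of_real (exp (- ((s * t)\<^sup>2) / 2)))" for t
    proof -
      have "\<tau> * (0 + s * t) = t * (u - x)"
        using assms by (simp add: \<tau>_def)
      then show ?thesis
        by (simp only: std_normal_density_def scaleR_conv_of_real) simp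
    qed
    then have "(CLINT t|lborel. std_normal_density (0 + s * t) *\<^sub>R iexp (\<tau> * (0 + s * t))) =
        complex_of_real (1 / sqrt (2 * pi)) * (CLINT t|lborel. iexp (t * (u - x)) * complex_of_real (exp (- ((s * t)\<^sup>2) / 2)))"
      by (simp only: integral_mult_right_zero)
    then show ?thesis
      using assms by (simp add: scaleR_conv_of_real)
  qed
  finally have "complex_of_real (exp (- (\<tau>\<^sup>2) / 2)) = s / sqrt (2 * pi) *
      (CLINT t|lborel. iexp (t * (u - x)) * complex_of_real (exp (- ((s * t)\<^sup>2) / 2)))" .
  moreover have "normal_density u s x = sqrt (2 * pi) / s * exp (- (\<tau>\<^sup>2) / 2) / (2 * pi)"
  proof -
    have "sqrt (2 * pi * s\<^sup>2) = sqrt (2 * pi) * s"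
      using assms by (simp add: real_sqrt_mult)
    moreover have "sqrt (2 * pi) * sqrt (2 * pi) = 2 * pi" by simp
    moreover have "-(x - u)\<^sup>2 / (2 * s\<^sup>2) = - (\<tau>\<^sup>2) / 2"
      by (simp add: \<tau>_def power_divide power2_commute)
    ultimately show ?thesis
      using assms unfolding normal_density_def by (simp add: field_simps)
  qed
  ultimately have "complex_of_real (normal_density u s x) =
      complex_of_real (sqrt (2 * pi) / s / (2 * pi)) * (s / sqrt (2 * pi) *
      (CLINT t|lborel. iexp (t * (u - x)) * complex_of_real (exp (- ((s * t)\<^sup>2) / 2))))"
    by (simp del: of_real_exp)
  moreover have "complex_of_real (sqrt (2 * pi) / s / (2 * pi)) * (complex_of_real (s / sqrt (2 * pi)) * z) = 1 / (2 * pi) * z" for z :: complex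
    using assms by simp
  ultimately show ?thesis
    by (simp only:)
qed

lemma integrable_gaussian:
  assumes "0 < (s::real)"
  shows "integrable lborel (\<lambda>t. exp (- ((s * t)\<^sup>2) / 2) :: real)"
proof -
  have "integrable lborel (\<lambda>t. sqrt (2 * pi * (1 / s)\<^sup>2) * normal_density 0 (1 / s) t)"
    using assms integrable_normal_density[of "1 / s"] by (intro integrable_mult_right) (auto simp: integrable_normal_density)
  also have "(\<lambda>t. sqrt (2 * pi * (1 / s)\<^sup>2) * normal_density 0 (1 / s) t) = (\<lambda>t. exp (- ((s * t)\<^sup>2) / 2))"
    using assms by (auto simp: normal_density_def field_simps power_mult_distrib real_sqrt_mult real_sqrt_divide)
  finally show ?thesis .
qed

context real_distribution
begin

text \<open>The Gaussian factor makes the double integral absolutely convergent, so that the inversion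
formula for the normal density may be integrated over its centre \<open>u\<close>.\<close>
lemma gaussian_smoothing_fourier:
  assumes "0 < s"
  shows "complex_of_real (\<integral>u. normal_density u s x \<partial>M) =
    1 / (2 * pi) * (CLINT t|lborel. iexp (- (t * x)) * char M t * complex_of_real (exp (- ((s * t)\<^sup>2) / 2)))"
proof -
  interpret P: pair_sigma_finite M lborel ..
  have meas: "(\<lambda>(u, t). iexp (t * (u - x)) * complex_of_real (exp (- ((s * t)\<^sup>2) / 2))) \<in> borel_measurable (M \<Otimes>\<^sub>M lborel)"
    by measurable
  have int: "integrable (M \<Otimes>\<^sub>M lborel) (\<lambda>(u, t). iexp (t * (u - x)) * complex_of_real (exp (- ((s * t)\<^sup>2) / 2)))"
  proof (rule P.Fubini_integrable[OF meas])
    show "integrable M (\<lambda>u. \<integral>t. norm (case (u, t) of (u, t) \<Rightarrow> iexp (t * (u - x)) * complex_of_real (exp (- ((s * t)\<^sup>2) / 2))) \<partial>lborel)"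
      by (simp add: norm_mult)
    have "integrable lborel (\<lambda>t. iexp (t * (u - x)) * complex_of_real (exp (- ((s * t)\<^sup>2) / 2)))" for u
      by (rule Bochner_Integration.integrable_bound[OF integrable_gaussian[of s]])
         (use assms in \<open>auto simp: norm_mult\<close>)
    then show "AE u in M. integrable lborel (\<lambda>t. case (u, t) of (u, t) \<Rightarrow> iexp (t * (u - x)) * complex_of_real (exp (- ((s * t)\<^sup>2) / 2)))"
      by simp
  qed
  have "complex_of_real (\<integral>u. normal_density u s x \<partial>M) = (CLINT u|M. normal_density u s x)"
    by simp
  also have "\<dots> = 1 / (2 * pi) * (CLINT u|M. CLINT t|lborel. iexp (t * (u - x)) * complex_of_real (exp (- ((s * t)\<^sup>2) / 2)))"
    by (simp only: normal_density_fourier_inversion[OF assms] integral_mult_right_zero)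
  also have "(CLINT u|M. CLINT t|lborel. iexp (t * (u - x)) * complex_of_real (exp (- ((s * t)\<^sup>2) / 2))) =
     (CLINT t|lborel. CLINT u|M. iexp (t * (u - x)) * complex_of_real (exp (- ((s * t)\<^sup>2) / 2)))"
    using P.Fubini_integral[OF int] by simp
  also have "\<dots> = (CLINT t|lborel. iexp (- (t * x)) * char M t * complex_of_real (exp (- ((s * t)\<^sup>2) / 2)))"
  proof (rule Bochner_Integration.integral_cong[OF refl])
    fix t :: real
    have "iexp (t * (u - x)) * complex_of_real (exp (- ((s * t)\<^sup>2) / 2)) = iexp (- (t * x)) * complex_of_real (exp (- ((s * t)\<^sup>2) / 2)) * iexp (t * u)" for u
      by (simp add: algebra_simps flip: exp_add)
    then have "(CLINT u|M. iexp (t * (u - x)) * complex_of_real (exp (- ((s * t)\<^sup>2) / 2))) =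
        iexp (- (t * x)) * complex_of_real (exp (- ((s * t)\<^sup>2) / 2)) * char M t"
      unfolding char_def by (simp only: integral_mult_right_zero)
    then show "(CLINT u|M. iexp (t * (u - x)) * complex_of_real (exp (- ((s * t)\<^sup>2) / 2))) =
        iexp (- (t * x)) * char M t * complex_of_real (exp (- ((s * t)\<^sup>2) / 2))"
      by simp
  qed
  finally show ?thesis .
qed

text \<open>Integrating the previous formula against \<open>M\<close> in the evaluation point as well turns the kernel into the
conjugate of the transform, which produces its squared modulus.\<close>
lemma gaussian_energy_fourier:
  assumes "0 < s"
  shows "(\<integral>v. (\<integral>u. normal_density u s v \<partial>M) \<partial>M) =
    1 / (2 * pi) * (\<integral>t. (cmod (char M t))\<^sup>2 * exp (- ((s * t)\<^sup>2) / 2) \<partial>lborel)"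
proof -
  interpret P: pair_sigma_finite M lborel ..
  let ?F = "\<lambda>v t. iexp (- (t * v)) * char M t * complex_of_real (exp (- ((s * t)\<^sup>2) / 2))"
  have meas: "(\<lambda>(v, t). ?F v t) \<in> borel_measurable (M \<Otimes>\<^sub>M lborel)"
    by measurable
  have int1: "integrable lborel (\<lambda>t. cmod (char M t) * exp (- ((s * t)\<^sup>2) / 2))"
    by (rule Bochner_Integration.integrable_bound[OF integrable_gaussian[of s]])
         (use assms cmod_char_le_1 in \<open>auto simp: norm_mult mult_left_le_one_le\<close>)
  have int: "integrable (M \<Otimes>\<^sub>M lborel) (\<lambda>(v, t). ?F v t)"
  proof (rule P.Fubini_integrable[OF meas])
    show "integrable M (\<lambda>u. \<integral>t. norm (case (u, t) of (v, t) \<Rightarrow> ?F v t) \<partial>lborel)"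
      by (simp add: norm_mult)
    have "integrable lborel (?F u)" for u
      by (rule Bochner_Integration.integrable_bound[OF int1])
         (use assms in \<open>auto simp: norm_mult\<close>)
    then show "AE u in M. integrable lborel (\<lambda>t. case (u, t) of (v, t) \<Rightarrow> ?F v t)"
      by simp
  qed
  have "complex_of_real (\<integral>v. (\<integral>u. normal_density u s v \<partial>M) \<partial>M) =
     (CLINT v|M. complex_of_real (\<integral>u. normal_density u s v \<partial>M))"
    by simp
  also have "\<dots> = 1 / (2 * pi) * (CLINT v|M. CLINT t|lborel. ?F v t)"
    by (simp only: gaussian_smoothing_fourier[OF assms] integral_mult_right_zero)
  also have "(CLINT v|M. CLINT t|lborel. ?F v t) = (CLINT t|lborel. CLINT v|M. ?F v t)"
    using P.Fubini_integral[OF int] by simp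
  also have "\<dots> = (CLINT t|lborel. complex_of_real ((cmod (char M t))\<^sup>2 * exp (- ((s * t)\<^sup>2) / 2)))"
  proof (rule Bochner_Integration.integral_cong[OF refl])
    fix t :: real
    have "(CLINT v|M. iexp (- (t * v))) = cnj (char M t)"
      unfolding char_def by (simp add: exp_cnj flip: Bochner_Integration.integral_cnj)
    moreover have "(CLINT v|M. ?F v t) = (CLINT v|M. (char M t * complex_of_real (exp (- ((s * t)\<^sup>2) / 2))) * iexp (- (t * v)))"
      by (simp add: mult_ac)
    ultimately have "(CLINT v|M. ?F v t) = (char M t * complex_of_real (exp (- ((s * t)\<^sup>2) / 2))) * cnj (char M t)"
      by (simp only: integral_mult_right_zero)
    also have "\<dots> = complex_of_real ((cmod (char M t))\<^sup>2 * exp (- ((s * t)\<^sup>2) / 2))"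
      by (simp only: of_real_mult complex_norm_square mult_ac)
    finally show "(CLINT v|M. ?F v t) = complex_of_real ((cmod (char M t))\<^sup>2 * exp (- ((s * t)\<^sup>2) / 2))" .
  qed
  also have "\<dots> = complex_of_real (\<integral>t. (cmod (char M t))\<^sup>2 * exp (- ((s * t)\<^sup>2) / 2) \<partial>lborel)"
    by (rule integral_complex_of_real)
  finally have "complex_of_real (\<integral>v. (\<integral>u. normal_density u s v \<partial>M) \<partial>M) =
    complex_of_real (1 / (2 * pi) * (\<integral>t. (cmod (char M t))\<^sup>2 * exp (- ((s * t)\<^sup>2) / 2) \<partial>lborel))"
    by (simp only: of_real_mult)
  then show ?thesis by (simp only: of_real_eq_iff)
qed

end

section \<open>Smoothing a probability measure by a normal law\<close>

lemma (in real_distribution) integrable_gaussian_kernel: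
  "0 < s \<Longrightarrow> integrable M (\<lambda>u. normal_density u s x)"
proof (rule integrable_const_bound[where B = "1 / sqrt (2 * pi * s\<^sup>2)"])
  show "AE u in M. norm (normal_density u s x) \<le> 1 / sqrt (2 * pi * s\<^sup>2)" if "0 < s"
    by (simp add: normal_density_def divide_right_mono)
  show "(\<lambda>u. normal_density u s x) \<in> borel_measurable M"
    unfolding normal_density_def by measurable
qed

lemma normal_density_measurable_pair[measurable (raw)]:
  assumes "f \<in> borel_measurable M" "g \<in> borel_measurable M"
  shows "(\<lambda>w. normal_density (f w) s (g w)) \<in> borel_measurable M"
  using assms unfolding normal_density_def by measurable

text \<open>The convolution of two centred normal laws with standard deviation \<open>s\<close> has standard deviation
\<open>sqrt 2 * s\<close>; a shift by \<open>v\<close> reduces the integral to that convolution.\<close>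
lemma normal_density_pair_convolution:
  assumes "0 < s"
  shows "(\<integral>\<^sup>+x. ennreal (normal_density u s x) * ennreal (normal_density v s x) \<partial>lborel) =
    ennreal (normal_density u (sqrt 2 * s) v)"
proof -
  have "(\<integral>\<^sup>+x. ennreal (normal_density u s x) * ennreal (normal_density v s x) \<partial>lborel) =
     (\<integral>\<^sup>+y. ennreal (normal_density u s (v + 1 * y)) * ennreal (normal_density v s (v + 1 * y)) \<partial>lborel)"
    by (subst nn_integral_real_affine[where c = 1 and t = v]) auto
  also have "\<dots> = (\<integral>\<^sup>+y. ennreal (normal_density 0 s ((u - v) - y) * normal_density 0 s y) \<partial>lborel)"
    by (intro nn_integral_cong)
       (simp add: normal_density_def ennreal_mult[symmetric] power2_commute diff_diff_eq add.commute
         algebra_simps)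
  also have "\<dots> = ennreal (normal_density 0 (sqrt (s\<^sup>2 + s\<^sup>2)) (u - v))"
    using conv_normal_density_zero_mean[OF assms assms] by meson
  also have "sqrt (s\<^sup>2 + s\<^sup>2) = sqrt 2 * s"
    using assms by (simp add: real_sqrt_mult flip: mult_2)
  finally show ?thesis
    by (simp add: normal_density_def power2_commute)
qed

context real_distribution
begin

definition smoothing :: "real \<Rightarrow> real \<Rightarrow> real" where
  "smoothing s x = (\<integral>u. normal_density u s x \<partial>M)"

lemma smoothing_measurable[measurable]: "smoothing s \<in> borel_measurable borel"
  unfolding smoothing_def by measurable

lemma smoothing_nonneg: "0 \<le> smoothing s x"
  unfolding smoothing_def by (intro integral_nonneg_AE) auto

lemma ennreal_smoothing:
  "0 < s \<Longrightarrow> ennreal (smoothing s x) = (\<integral>\<^sup>+u. normal_density u s x \<partial>M)"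
  unfolding smoothing_def by (intro nn_integral_eq_integral[symmetric] integrable_gaussian_kernel) auto

text \<open>Expanding the square and integrating over \<open>x\<close> first leaves the energy of \<open>M\<close> with respect
to a wider Gaussian kernel, which \<open>gaussian_energy_fourier\<close> evaluates. This is Parseval's
identity for the convolution of \<open>M\<close> with a normal law.\<close>
lemma smoothing_parseval:
  assumes "0 < s"
  shows "(\<integral>\<^sup>+x. ennreal ((smoothing s x)\<^sup>2) \<partial>lborel) =
    ennreal (1 / (2 * pi) * (\<integral>t. (cmod (char M t))\<^sup>2 * exp (- ((s * t)\<^sup>2)) \<partial>lborel))"
proof -
  interpret P: pair_sigma_finite M lborel ..
  have s2: "0 < sqrt 2 * s" using assms by simp
  have "(\<integral>\<^sup>+x. ennreal ((smoothing s x)\<^sup>2) \<partial>lborel) =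
     (\<integral>\<^sup>+x. (\<integral>\<^sup>+v. (\<integral>\<^sup>+u. ennreal (normal_density u s x) * ennreal (normal_density v s x) \<partial>M) \<partial>M) \<partial>lborel)"
    using assms by (intro nn_integral_cong)
      (simp add: power2_eq_square ennreal_mult ennreal_smoothing smoothing_nonneg nn_integral_multc nn_integral_cmult)
  also have "\<dots> = (\<integral>\<^sup>+v. (\<integral>\<^sup>+x. (\<integral>\<^sup>+u. ennreal (normal_density u s x) * ennreal (normal_density v s x) \<partial>M) \<partial>lborel) \<partial>M)"
    by (rule P.Fubini') measurable
  also have "\<dots> = (\<integral>\<^sup>+v. (\<integral>\<^sup>+u. (\<integral>\<^sup>+x. ennreal (normal_density u s x) * ennreal (normal_density v s x) \<partial>lborel) \<partial>M) \<partial>M)"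
    by (intro nn_integral_cong P.Fubini') measurable
  also have "\<dots> = (\<integral>\<^sup>+v. ennreal (smoothing (sqrt 2 * s) v) \<partial>M)"
    by (simp add: normal_density_pair_convolution[OF assms] ennreal_smoothing[OF s2])
  also have "\<dots> = ennreal (\<integral>v. smoothing (sqrt 2 * s) v \<partial>M)"
  proof (rule nn_integral_eq_integral)
    show "integrable M (smoothing (sqrt 2 * s))"
    proof (rule integrable_const_bound[where B = "1 / sqrt (2 * pi * (sqrt 2 * s)\<^sup>2)"])
      have "smoothing (sqrt 2 * s) x \<le> (\<integral>u. 1 / sqrt (2 * pi * (sqrt 2 * s)\<^sup>2) \<partial>M)" for x
        unfolding smoothing_def using integrable_gaussian_kernel[OF s2]
        by (intro integral_mono) (auto simp add: normal_density_def divide_right_mono)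
      then show "AE x in M. norm (smoothing (sqrt 2 * s) x) \<le> 1 / sqrt (2 * pi * (sqrt 2 * s)\<^sup>2)"
        using prob_space by (simp add: smoothing_nonneg)
    qed simp
  qed (simp add: smoothing_nonneg)
  also have "(\<integral>v. smoothing (sqrt 2 * s) v \<partial>M) =
      1 / (2 * pi) * (\<integral>t. (cmod (char M t))\<^sup>2 * exp (- ((sqrt 2 * s * t)\<^sup>2) / 2) \<partial>lborel)"
    unfolding smoothing_def by (rule gaussian_energy_fourier[OF s2])
  finally show ?thesis
    by (simp add: power_mult_distrib)
qed

text \<open>The density \<open>smoothing s\<close> is that of the law of \<open>u + s z\<close> for independent \<open>u\<close> with law \<open>M\<close>
and \<open>z\<close> standard normal.\<close>
lemma smoothing_nn_integral:
  assumes "0 < s" and [measurable]: "g \<in> borel_measurable borel"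
  shows "(\<integral>\<^sup>+x. g x * ennreal (smoothing s x) \<partial>lborel) =
    (\<integral>\<^sup>+(u, z). g (u + s * z) \<partial>(M \<Otimes>\<^sub>M std_normal_distribution))"
proof -
  interpret P: pair_sigma_finite M lborel ..
  interpret N: prob_space std_normal_distribution
    by (simp add: prob_space_normal_density)
  have "(\<integral>\<^sup>+x. g x * ennreal (smoothing s x) \<partial>lborel) =
      (\<integral>\<^sup>+x. (\<integral>\<^sup>+u. g x * ennreal (normal_density u s x) \<partial>M) \<partial>lborel)"
    using assms by (simp add: ennreal_smoothing nn_integral_cmult)
  also have "\<dots> = (\<integral>\<^sup>+u. (\<integral>\<^sup>+x. g x * ennreal (normal_density u s x) \<partial>lborel) \<partial>M)"
    by (rule P.Fubini') measurable
  also have "\<dots> = (\<integral>\<^sup>+u. (\<integral>\<^sup>+z. g (u + s * z) \<partial>std_normal_distribution) \<partial>M)"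
  proof (rule nn_integral_cong)
    fix u
    have "(\<integral>\<^sup>+x. g x * ennreal (normal_density u s x) \<partial>lborel) =
      ennreal \<bar>s\<bar> * (\<integral>\<^sup>+z. g (u + s * z) * ennreal (normal_density u s (u + s * z)) \<partial>lborel)"
      using assms by (intro nn_integral_real_affine) auto
    also have "\<dots> = (\<integral>\<^sup>+z. ennreal \<bar>s\<bar> * (g (u + s * z) * ennreal (normal_density u s (u + s * z))) \<partial>lborel)"
      by (subst nn_integral_cmult) auto
    also have "\<dots> = (\<integral>\<^sup>+z. ennreal (std_normal_density z) * g (u + s * z) \<partial>lborel)"
    proof (rule nn_integral_cong)
      fix z
      have "\<bar>s\<bar> * normal_density u s (u + s * z) = std_normal_density z"
        using assms by (simp add: normal_density_def real_sqrt_mult power_mult_distrib)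
      then have "ennreal \<bar>s\<bar> * ennreal (normal_density u s (u + s * z)) = ennreal (std_normal_density z)"
        by (simp flip: ennreal_mult)
      then show "ennreal \<bar>s\<bar> * (g (u + s * z) * ennreal (normal_density u s (u + s * z))) =
          ennreal (std_normal_density z) * g (u + s * z)"
        by (metis mult.assoc mult.commute)
    qed
    also have "\<dots> = (\<integral>\<^sup>+z. g (u + s * z) \<partial>std_normal_distribution)"
      by (subst nn_integral_density) auto
    finally show "(\<integral>\<^sup>+x. g x * ennreal (normal_density u s x) \<partial>lborel) =
       (\<integral>\<^sup>+z. g (u + s * z) \<partial>std_normal_distribution)" .
  qed
  also have "\<dots> = (\<integral>\<^sup>+(u, z). g (u + s * z) \<partial>(M \<Otimes>\<^sub>M std_normal_distribution))"
    by (subst N.nn_integral_fst[symmetric]) (auto simp: split_beta')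
  finally show ?thesis .
qed

text \<open>With the normal variable \<open>z\<close> kept fixed, \<open>u + s z\<close> tends to \<open>u\<close> as \<open>s\<close> tends to 0, so
dominated convergence on the product space applies.\<close>
lemma smoothing_weak_limit:
  fixes g :: "real \<Rightarrow> real"
  assumes g: "continuous_on UNIV g" "\<And>x. 0 \<le> g x" "\<And>x. g x \<le> B"
  shows "(\<lambda>n. \<integral>\<^sup>+x. ennreal (g x) * ennreal (smoothing (inverse (Suc n)) x) \<partial>lborel)
    \<longlonglongrightarrow> (\<integral>\<^sup>+x. g x \<partial>M)"
proof -
  interpret N: prob_space std_normal_distribution
    by (simp add: prob_space_normal_density)
  interpret MN: pair_prob_space M std_normal_distribution ..
  have [measurable]: "g \<in> borel_measurable borel"
    using g(1) by (rule borel_measurable_continuous_onI)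
  have "(\<lambda>n. \<integral>\<^sup>+w. ennreal (g (fst w + inverse (Suc n) * snd w)) \<partial>(M \<Otimes>\<^sub>M std_normal_distribution))
     \<longlonglongrightarrow> (\<integral>\<^sup>+w. ennreal (g (fst w)) \<partial>(M \<Otimes>\<^sub>M std_normal_distribution))"
  proof (rule nn_integral_dominated_convergence[where w = "\<lambda>_. ennreal B"])
    show "(\<integral>\<^sup>+x. ennreal B \<partial>(M \<Otimes>\<^sub>M std_normal_distribution)) < \<infinity>"
      by (simp add: MN.emeasure_space_1)
    have "(\<lambda>n. g (x + inverse (Suc n) * z)) \<longlonglongrightarrow> g x" for x z
    proof (rule continuous_on_tendsto_compose[OF g(1)])
      have "(\<lambda>n. x + inverse (real (Suc n)) * z) \<longlonglongrightarrow> x + 0 * z"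
        by (intro tendsto_intros LIMSEQ_inverse_real_of_nat)
      then show "(\<lambda>n. x + inverse (real (Suc n)) * z) \<longlonglongrightarrow> x" by simp
    qed auto
    then show "AE w in M \<Otimes>\<^sub>M std_normal_distribution.
        (\<lambda>n. ennreal (g (fst w + inverse (Suc n) * snd w))) \<longlonglongrightarrow> ennreal (g (fst w))"
      by (intro AE_I2 tendsto_ennrealI) auto
  qed (use g in \<open>auto intro!: ennreal_leI\<close>)
  moreover have "(\<integral>\<^sup>+w. ennreal (g (fst w)) \<partial>(M \<Otimes>\<^sub>M std_normal_distribution)) = (\<integral>\<^sup>+x. g x \<partial>M)"
    using N.emeasure_space_1 by (subst N.nn_integral_fst[symmetric]) auto
  ultimately show ?thesis
    by (simp add: smoothing_nn_integral split_beta')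
qed

end

section \<open>Test functions and absolute continuity\<close>

text \<open>The witnesses are multiples of the distance to the complement, cut off at 1. That distance is 0
by convention when the complement is empty, so the whole line is a separate case.\<close>
lemma open_indicator_incseq_continuous:
  fixes U :: "real set"
  assumes "open U"
  obtains g :: "nat \<Rightarrow> real \<Rightarrow> real" where "\<And>n. continuous_on UNIV (g n)"
    "\<And>n x. 0 \<le> g n x" "\<And>n x. g n x \<le> 1" "\<And>n x. x \<notin> U \<Longrightarrow> g n x = 0" "incseq g"
    "\<And>x. (\<lambda>n. g n x) \<longlonglongrightarrow> indicator U x"
proof (cases "U = UNIV")
  case True
  show ?thesis
    by (rule that[of "\<lambda>_ _. 1"]) (auto simp: True incseq_def)
next
  case False
  then have ne: "- U \<noteq> {}" by auto
  define g where "g n x = min 1 (real n * infdist x (- U))" for n x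
  show ?thesis
  proof (rule that[of g])
    show "continuous_on UNIV (g n)" for n
      unfolding g_def by (intro continuous_intros)
    show "0 \<le> g n x" "g n x \<le> 1" for n x
      by (auto simp: g_def infdist_nonneg)
    show "g n x = 0" if "x \<notin> U" for n x
      using that by (simp add: g_def)
    show "incseq g"
      unfolding incseq_def le_fun_def g_def
      by (intro allI impI min.mono mult_right_mono) (auto simp: infdist_nonneg)
    show "(\<lambda>n. g n x) \<longlonglongrightarrow> indicator U x" for x
    proof (cases "x \<in> U")
      case True
      then have pos: "0 < infdist x (- U)"
        using assms ne in_closed_iff_infdist_zero[of "- U" x] infdist_nonneg[of x "- U"] by force
      obtain m where m: "1 < real m * infdist x (- U)"
        using reals_Archimedean3[OF pos] by auto
      have "g n x = 1" if "n \<ge> m" for n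
      proof -
        have "real m * infdist x (- U) \<le> real n * infdist x (- U)"
          using that pos by (intro mult_right_mono) auto
        then show ?thesis using m by (simp add: g_def)
      qed
      then show ?thesis
        using True by (intro tendsto_eventually) (auto simp: eventually_sequentially)
    next
      case False
      then show ?thesis by (simp add: g_def)
    qed
  qed
qed

text \<open>Test functions with bounded support suffice because the bounded open intervals generate the
Borel sets. This matters where convergence is dominated on bounded sets only.\<close>
lemma finite_measure_eqI_test_functions:
  fixes M N :: "real measure"
  assumes "finite_measure M" and [measurable_cong]: "sets M = sets borel" "sets N = sets borel"
    and eq: "\<And>g R. continuous_on UNIV g \<Longrightarrow> (\<And>x. 0 \<le> g x) \<Longrightarrow> (\<And>x. g x \<le> 1) \<Longrightarrow>
      (\<And>x. x \<notin> {-R..R} \<Longrightarrow> g x = 0) \<Longrightarrow> (\<integral>\<^sup>+x. ennreal (g x) \<partial>M) = (\<integral>\<^sup>+x. ennreal (g x) \<partial>N)"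
  shows "M = N"
proof (rule measure_eqI_generator_eq[where \<Omega> = UNIV and E = "range (\<lambda>(a, b). {a<..<b})" and A = "\<lambda>i. {- real i<..<real i}"])
  interpret finite_measure M by fact
  show "Int_stable (range (\<lambda>(a, b). {a<..<b::real}))"
    by (auto simp: Int_stable_def)
  show "sets M = sigma_sets UNIV (range (\<lambda>(a, b). {a<..<b::real}))" "sets N = sigma_sets UNIV (range (\<lambda>(a, b). {a<..<b::real}))"
    using assms by (simp_all add: borel_eq_box)
  show "(\<Union>i. {- real i<..<real i}) = UNIV"
  proof (intro equalityI subsetI)
    fix x :: real
    obtain n where "\<bar>x\<bar> < real n" using reals_Archimedean2 by blast
    then show "x \<in> (\<Union>i. {- real i<..<real i})" by (auto simp: abs_less_iff intro!: exI[of _ n])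
  qed auto
  show "emeasure M {- real i<..<real i} \<noteq> \<infinity>" for i
    by (simp add: emeasure_finite)
  fix X assume "X \<in> range (\<lambda>(a, b). {a<..<b::real})"
  then obtain a b where X: "X = {a<..<b}" by auto
  obtain g :: "nat \<Rightarrow> real \<Rightarrow> real" where g: "\<And>n. continuous_on UNIV (g n)"
    "\<And>n x. 0 \<le> g n x" "\<And>n x. g n x \<le> 1" "\<And>n x. x \<notin> {a<..<b} \<Longrightarrow> g n x = 0" "incseq g"
    "\<And>x. (\<lambda>n. g n x) \<longlonglongrightarrow> indicator {a<..<b} x"
    by (rule open_indicator_incseq_continuous[of "{a<..<b}"]) auto
  have [measurable]: "g n \<in> borel_measurable borel" for n
    using g(1) by (rule borel_measurable_continuous_onI)
  have lim: "(\<lambda>n. \<integral>\<^sup>+x. ennreal (g n x) \<partial>L) \<longlonglongrightarrow> emeasure L X" if [measurable_cong]: "sets L = sets borel" for L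
  proof -
    have "(\<lambda>n. \<integral>\<^sup>+x. ennreal (g n x) \<partial>L) \<longlonglongrightarrow> (\<integral>\<^sup>+x. ennreal (indicator {a<..<b} x) \<partial>L)"
    proof (rule nn_integral_LIMSEQ)
      show "incseq (\<lambda>n x. ennreal (g n x))"
        using g(5) by (auto simp: incseq_def le_fun_def intro!: ennreal_leI)
    qed (auto intro!: tendsto_ennrealI g(6))
    also have "(\<integral>\<^sup>+x. ennreal (indicator {a<..<b} x) \<partial>L) = emeasure L X"
      by (simp add: X that ennreal_indicator)
    finally show ?thesis .
  qed
  have "(\<integral>\<^sup>+x. ennreal (g n x) \<partial>M) = (\<integral>\<^sup>+x. ennreal (g n x) \<partial>N)" for n
  proof (rule eq[where R = "max \<bar>a\<bar> \<bar>b\<bar>"])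
    show "g n x = 0" if "x \<notin> {- max \<bar>a\<bar> \<bar>b\<bar>..max \<bar>a\<bar> \<bar>b\<bar>}" for x
      using that by (intro g(4)) auto
  qed (use g in auto)
  then show "emeasure M X = emeasure N X"
    using lim[of M] lim[of N] assms by (simp add: LIMSEQ_unique)
qed auto

context real_distribution
begin

text \<open>The smoothed densities \<open>p\<close> satisfy \<open>2 g p \<le> c g\<^sup>2 + p\<^sup>2 / c\<close>, and by Parseval's identity
the integral of \<open>p\<^sup>2\<close> is at most the constant below, whatever the width of the Gaussian. The
estimate passes to the weak limit. The free parameter \<open>c\<close> replaces the Cauchy-Schwarz inequality.\<close>
lemma char_square_test_function_bound:
  fixes g :: "real \<Rightarrow> real"
  assumes int: "integrable lborel (\<lambda>t. (cmod (char M t))\<^sup>2)"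
    and g: "continuous_on UNIV g" "\<And>x. 0 \<le> g x" "\<And>x. g x \<le> B" and "0 < c"
  shows "2 * (\<integral>\<^sup>+x. ennreal (g x) \<partial>M) \<le> ennreal c * (\<integral>\<^sup>+x. ennreal ((g x)\<^sup>2) \<partial>lborel) +
    ennreal ((\<integral>t. (cmod (char M t))\<^sup>2 \<partial>lborel) / (2 * pi) / c)"
proof (rule LIMSEQ_le_const2)
  let ?C = "(\<integral>t. (cmod (char M t))\<^sup>2 \<partial>lborel) / (2 * pi)"
  have [measurable]: "g \<in> borel_measurable borel"
    using g(1) by (rule borel_measurable_continuous_onI)
  show "(\<lambda>n. 2 * (\<integral>\<^sup>+x. ennreal (g x) * ennreal (smoothing (inverse (Suc n)) x) \<partial>lborel))
    \<longlonglongrightarrow> 2 * (\<integral>\<^sup>+x. ennreal (g x) \<partial>M)"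
    by (intro ennreal_tendsto_cmult smoothing_weak_limit[OF g]) auto
  have "2 * (\<integral>\<^sup>+x. ennreal (g x) * ennreal (smoothing s x) \<partial>lborel) \<le>
     ennreal c * (\<integral>\<^sup>+x. ennreal ((g x)\<^sup>2) \<partial>lborel) + ennreal (?C / c)" if "0 < s" for s
  proof -
    have "2 * (g x * smoothing s x) \<le> c * (g x)\<^sup>2 + 1 / c * (smoothing s x)\<^sup>2" for x
    proof -
      have "0 \<le> (c * g x - smoothing s x)\<^sup>2 / c" using \<open>0 < c\<close> by simp
      also have "\<dots> = c * (g x)\<^sup>2 + 1 / c * (smoothing s x)\<^sup>2 - 2 * (g x * smoothing s x)"
        using \<open>0 < c\<close> by (simp add: field_simps power2_eq_square)
      finally show ?thesis by simp
    qed
    then have "ennreal (2 * (g x * smoothing s x)) \<le> ennreal (c * (g x)\<^sup>2 + 1 / c * (smoothing s x)\<^sup>2)" for x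
      by (rule ennreal_leI)
    then have pt: "2 * (ennreal (g x) * ennreal (smoothing s x)) \<le>
        ennreal c * ennreal ((g x)\<^sup>2) + ennreal (1 / c) * ennreal ((smoothing s x)\<^sup>2)" for x
      using \<open>0 < c\<close> by (simp add: g smoothing_nonneg ennreal_mult[symmetric] ennreal_plus[symmetric]
        ennreal_mult'[of 2, simplified] del: ennreal_plus)
    have "2 * (\<integral>\<^sup>+x. ennreal (g x) * ennreal (smoothing s x) \<partial>lborel) =
        (\<integral>\<^sup>+x. 2 * (ennreal (g x) * ennreal (smoothing s x)) \<partial>lborel)"
      by (subst nn_integral_cmult) auto
    also have "\<dots> \<le> (\<integral>\<^sup>+x. ennreal c * ennreal ((g x)\<^sup>2) + ennreal (1 / c) * ennreal ((smoothing s x)\<^sup>2) \<partial>lborel)"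
      by (intro nn_integral_mono pt)
    also have "\<dots> = ennreal c * (\<integral>\<^sup>+x. ennreal ((g x)\<^sup>2) \<partial>lborel) +
        ennreal (1 / c) * (\<integral>\<^sup>+x. ennreal ((smoothing s x)\<^sup>2) \<partial>lborel)"
      by (simp add: nn_integral_add nn_integral_cmult)
    also have "(\<integral>\<^sup>+x. ennreal ((smoothing s x)\<^sup>2) \<partial>lborel) \<le> ennreal ?C"
    proof -
      have "(\<integral>t. (cmod (char M t))\<^sup>2 * exp (- ((s * t)\<^sup>2)) \<partial>lborel) \<le> (\<integral>t. (cmod (char M t))\<^sup>2 \<partial>lborel)"
        by (rule integral_mono'[OF int]) (auto simp: mult_left_le)
      then show ?thesis
        unfolding smoothing_parseval[OF that] by (intro ennreal_leI) (simp add: divide_right_mono)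
    qed
    also have "ennreal (1 / c) * ennreal ?C = ennreal (?C / c)"
      using \<open>0 < c\<close> by (simp add: ennreal_mult'[symmetric])
    finally show ?thesis by (simp add: add_left_mono mult_left_mono)
  qed
  then show "\<exists>N. \<forall>n\<ge>N. 2 * (\<integral>\<^sup>+x. ennreal (g x) * ennreal (smoothing (inverse (Suc n)) x) \<partial>lborel)
     \<le> ennreal c * (\<integral>\<^sup>+x. ennreal ((g x)\<^sup>2) \<partial>lborel) + ennreal (?C / c)"
    by (intro exI[of _ 0]) auto
qed

text \<open>For \<open>g\<close> between 0 and the indicator of an open set \<open>U\<close>, the test function bound gives
\<open>2 M(U) \<le> c \<lambda>(U) + C / c\<close>, where \<open>\<lambda>(U)\<close> is the length of \<open>U\<close>. A null set is contained in such sets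
with arbitrarily small length, so letting \<open>c\<close> grow while \<open>\<lambda>(U) \<le> 1 / c\<^sup>2\<close> makes the bound tend to 0.\<close>
lemma char_square_integrable_imp_absolutely_continuous:
  assumes int: "integrable lborel (\<lambda>t. (cmod (char M t))\<^sup>2)"
  shows "absolutely_continuous lborel M"
  unfolding absolutely_continuous_def
proof
  fix N :: "real set" assume N: "N \<in> null_sets lborel"
  define C where "C = (\<integral>t. (cmod (char M t))\<^sup>2 \<partial>lborel) / (2 * pi)"
  have C: "0 \<le> C" unfolding C_def by simp
  have bound: "2 * emeasure M N \<le> ennreal ((1 + C) * inverse (real (Suc n)))" for n
  proof -
    define c where "c = real (Suc n)"
    have c: "0 < c" by (simp add: c_def)
    have "N \<in> sets borel" using N by auto
    then obtain U where U: "open U" "N \<subseteq> U" "emeasure lborel (U - N) < ennreal (1 / c\<^sup>2)"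
      using outer_regular_lborel[of N "1 / c\<^sup>2"] c by auto
    have [measurable]: "U \<in> sets borel" using U by auto
    have "emeasure lborel U = emeasure lborel (U - N)"
      using N by (intro emeasure_Diff_null_set[symmetric]) auto
    then have lU: "emeasure lborel U \<le> ennreal (1 / c\<^sup>2)"
      using U(3) by simp
    obtain g :: "nat \<Rightarrow> real \<Rightarrow> real" where g: "\<And>n. continuous_on UNIV (g n)"
      "\<And>n x. 0 \<le> g n x" "\<And>n x. g n x \<le> 1" "\<And>n x. x \<notin> U \<Longrightarrow> g n x = 0" "incseq g"
      "\<And>x. (\<lambda>n. g n x) \<longlonglongrightarrow> indicator U x"
      using open_indicator_incseq_continuous[OF U(1)] by metis
    have [measurable]: "g n \<in> borel_measurable borel" for n
      using g(1) by (rule borel_measurable_continuous_onI)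
    have "(\<lambda>n. \<integral>\<^sup>+x. ennreal (g n x) \<partial>M) \<longlonglongrightarrow> (\<integral>\<^sup>+x. ennreal (indicator U x) \<partial>M)"
    proof (rule nn_integral_LIMSEQ)
      show "incseq (\<lambda>n x. ennreal (g n x))"
        using g(5) by (auto simp: incseq_def le_fun_def intro!: ennreal_leI)
    qed (auto intro!: tendsto_ennrealI g(6))
    then have "(\<lambda>n. 2 * (\<integral>\<^sup>+x. ennreal (g n x) \<partial>M)) \<longlonglongrightarrow> 2 * emeasure M U"
      by (intro ennreal_tendsto_cmult) (auto simp: ennreal_indicator)
    moreover have "2 * (\<integral>\<^sup>+x. ennreal (g k x) \<partial>M) \<le> ennreal c * ennreal (1 / c\<^sup>2) + ennreal (C / c)" for k
    proof -
      have "(\<integral>\<^sup>+x. ennreal ((g k x)\<^sup>2) \<partial>lborel) \<le> (\<integral>\<^sup>+x. indicator U x \<partial>lborel)"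
      proof (rule nn_integral_mono)
        fix x
        show "ennreal ((g k x)\<^sup>2) \<le> indicator U x"
          using g(2,3)[of k x] g(4)[of x k]
          by (cases "x \<in> U") (auto simp: power_le_one ennreal_le_1)
      qed
      then have "(\<integral>\<^sup>+x. ennreal ((g k x)\<^sup>2) \<partial>lborel) \<le> ennreal (1 / c\<^sup>2)"
        using lU by simp
      then show ?thesis
        using char_square_test_function_bound[OF int g(1,2,3) c, of k]
        unfolding C_def by (meson add_right_mono mult_left_mono order_trans zero_le)
    qed
    ultimately have "2 * emeasure M U \<le> ennreal c * ennreal (1 / c\<^sup>2) + ennreal (C / c)"
      by (intro LIMSEQ_le_const2) auto
    moreover have "2 * emeasure M N \<le> 2 * emeasure M U"
      using U by (intro mult_left_mono emeasure_mono) auto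
    moreover have "ennreal c * ennreal (1 / c\<^sup>2) + ennreal (C / c) = ennreal ((1 + C) * inverse c)"
      using c C by (simp add: ennreal_mult[symmetric] ennreal_plus[symmetric] field_simps power2_eq_square del: ennreal_plus)
    ultimately show ?thesis by (simp add: c_def)
  qed
  have "(\<lambda>n. ennreal ((1 + C) * inverse (real (Suc n)))) \<longlonglongrightarrow> ennreal ((1 + C) * 0)"
    by (intro tendsto_ennrealI tendsto_intros LIMSEQ_inverse_real_of_nat)
  then have "2 * emeasure M N \<le> ennreal ((1 + C) * 0)"
    by (rule LIMSEQ_le_const) (use bound in auto)
  then show "N \<in> null_sets M"
    using N by (auto simp: null_sets_def)
qed

end

section \<open>Densities from the integrability of the transform\<close>

context real_distribution
begin

text \<open>Once a density \<open>f\<close> exists, let \<open>h\<close> be its truncation in height and in space. If \<open>h\<close> could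
serve as a test function with \<open>c = 1\<close>, then
\<open>2 \<integral>h\<^sup>2 \<le> 2 \<integral>h f \<le> \<integral>h\<^sup>2 + C\<close>, hence \<open>\<integral>h\<^sup>2 \<le> C\<close> independently of the truncation.
Being only measurable, \<open>h\<close> is first approximated almost everywhere by continuous functions; since
\<open>M\<close> is absolutely continuous, the exceptional set is also null for \<open>M\<close>.\<close>
theorem char_square_integrable_imp_L2_density:
  assumes int: "integrable lborel (\<lambda>t. (cmod (char M t))\<^sup>2)"
  obtains f where "f \<in> borel_measurable borel" "\<And>x. 0 \<le> f x"
    "M = density lborel (\<lambda>x. ennreal (f x))" "integrable lborel (\<lambda>x. (f x)\<^sup>2)"
proof -
  have ac: "absolutely_continuous lborel M"
    by (rule char_square_integrable_imp_absolutely_continuous[OF int])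
  obtain f where f: "f \<in> borel_measurable lborel" "AE x in lborel. RN_deriv lborel M x = ennreal (f x)"
      "\<And>x. 0 \<le> f x"
    using sigma_finite_measure.real_RN_deriv[OF lborel.sigma_finite_measure_axioms finite_measure_axioms ac] by auto
  have [measurable]: "f \<in> borel_measurable borel" using f(1) by simp
  have "M = density lborel (RN_deriv lborel M)"
    using sigma_finite_measure.density_RN_deriv[OF lborel.sigma_finite_measure_axioms ac] by simp
  also have "\<dots> = density lborel (\<lambda>x. ennreal (f x))"
    using f(2) by (intro density_cong) auto
  finally have M: "M = density lborel (\<lambda>x. ennreal (f x))" .
  \<comment> \<open>the bound for the integral of \<open>f\<^sup>2\<close>\<close>
  define C where "C = (\<integral>t. (cmod (char M t))\<^sup>2 \<partial>lborel) / (2 * pi)"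
  define h where "h n x = min (f x) (real n) * indicator {- real n..real n} x" for n x
  have hm[measurable]: "h n \<in> borel_measurable borel" for n
    unfolding h_def by measurable
  have h0: "0 \<le> h n x" "h n x \<le> real n" "h n x \<le> f x" for n x
    by (auto simp: h_def f indicator_def)
  have trunc: "(\<integral>\<^sup>+x. ennreal ((h n x)\<^sup>2) \<partial>lborel) \<le> ennreal C" for n
  proof -
    define \<theta> where "\<theta> x = max 0 (min 1 (real n + 1 - \<bar>x\<bar>))" for x :: real
    have \<theta>: "0 \<le> \<theta> x" "\<theta> x \<le> 1" "x \<notin> {- (real n + 1)..real n + 1} \<Longrightarrow> \<theta> x = 0"
        "x \<in> {- real n..real n} \<Longrightarrow> \<theta> x = 1" for x
      by (auto simp: \<theta>_def)
    have "h n \<in> borel_measurable lebesgue"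
      by (intro measurable_completion) simp
    then have "h n measurable_on UNIV"
      by (rule lebesgue_measurable_imp_measurable_on_real) auto
    then obtain N g where N: "negligible N" and g: "\<And>k. continuous_on UNIV (g k)"
        "\<And>x. x \<notin> N \<Longrightarrow> (\<lambda>k. g k x) \<longlonglongrightarrow> h n x" for k :: nat
      unfolding measurable_on_def by auto
    \<comment> \<open>clamping to the range of \<open>h\<close> and multiplying by a cutoff that is 1 on its support
      keeps the limit and makes both integrals dominated\<close>
    define G where "G k x = max 0 (min (real n) (g k x)) * \<theta> x" for k x
    have G: "continuous_on UNIV (G k)" "0 \<le> G k x" "G k x \<le> real n" for k x
    proof -
      show "continuous_on UNIV (G k)"
        unfolding G_def \<theta>_def by (intro continuous_intros g)
      have "max 0 (min (real n) (g k x)) * \<theta> x \<le> real n * 1"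
        using \<theta>[of x] by (intro mult_mono) auto
      then show "0 \<le> G k x" "G k x \<le> real n"
        using \<theta>[of x] by (auto simp: G_def)
    qed
    have [measurable]: "G k \<in> borel_measurable borel" for k
      using G(1) by (rule borel_measurable_continuous_onI)
    have "N \<in> null_sets lebesgue"
      using N by (simp add: negligible_iff_null_sets)
    then have "AE x in lebesgue. x \<notin> N" by (rule AE_not_in)
    moreover have "(\<lambda>k. G k x) \<longlonglongrightarrow> h n x" if "x \<notin> N" for x
    proof -
      have "(\<lambda>k. G k x) \<longlonglongrightarrow> max 0 (min (real n) (h n x)) * \<theta> x"
        unfolding G_def by (intro tendsto_intros g that)
      also have "max 0 (min (real n) (h n x)) * \<theta> x = h n x"
        using h0[of n x] \<theta>(4)[of x] by (cases "x \<in> {- real n..real n}") (auto simp: h_def)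
      finally show ?thesis .
    qed
    ultimately have "AE x in lebesgue. (\<lambda>k. G k x) \<longlonglongrightarrow> h n x"
      by (auto elim: eventually_mono)
    then have conv: "AE x in lborel. (\<lambda>k. G k x) \<longlonglongrightarrow> h n x"
      by (simp add: AE_completion_iff)
    have convM: "AE x in M. (\<lambda>k. G k x) \<longlonglongrightarrow> h n x"
      using absolutely_continuous_AE[OF _ ac conv] by simp
    have lim1: "(\<lambda>k. \<integral>\<^sup>+x. ennreal (G k x) \<partial>M) \<longlonglongrightarrow> (\<integral>\<^sup>+x. ennreal (h n x) \<partial>M)"
    proof (rule nn_integral_dominated_convergence[where w = "\<lambda>_. ennreal (real n)"])
      show "AE x in M. (\<lambda>k. ennreal (G k x)) \<longlonglongrightarrow> ennreal (h n x)"
        using convM by (auto elim!: eventually_mono intro: tendsto_ennrealI)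
    qed (use G in \<open>auto intro!: ennreal_leI simp: ennreal_mult_less_top emeasure_eq_measure\<close>)
    have lim2: "(\<lambda>k. \<integral>\<^sup>+x. ennreal ((G k x)\<^sup>2) \<partial>lborel) \<longlonglongrightarrow> (\<integral>\<^sup>+x. ennreal ((h n x)\<^sup>2) \<partial>lborel)"
    proof (rule nn_integral_dominated_convergence[where w = "\<lambda>x. ennreal ((real n)\<^sup>2) * indicator {- (real n + 1)..real n + 1} x"])
      show "AE x in lborel. (\<lambda>k. ennreal ((G k x)\<^sup>2)) \<longlonglongrightarrow> ennreal ((h n x)\<^sup>2)"
        using conv by (auto elim!: eventually_mono intro!: tendsto_ennrealI tendsto_intros)
      show "(\<integral>\<^sup>+x. ennreal ((real n)\<^sup>2) * indicator {- (real n + 1)..real n + 1} x \<partial>lborel) < \<infinity>"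
        by (subst nn_integral_cmult) (auto simp: ennreal_mult_less_top)
      show "AE x in lborel. ennreal ((G k x)\<^sup>2) \<le> ennreal ((real n)\<^sup>2) * indicator {- (real n + 1)..real n + 1} x" for k
      proof (rule AE_I2)
        fix x
        show "ennreal ((G k x)\<^sup>2) \<le> ennreal ((real n)\<^sup>2) * indicator {- (real n + 1)..real n + 1} x"
          using G(2,3)[of k x] \<theta>(3)[of x]
          by (cases "x \<in> {- (real n + 1)..real n + 1}") (auto simp: G_def intro!: ennreal_leI power_mono)
      qed
    qed auto
    have "2 * (\<integral>\<^sup>+x. ennreal (h n x) \<partial>M) \<le> (\<integral>\<^sup>+x. ennreal ((h n x)\<^sup>2) \<partial>lborel) + ennreal C"
    proof (rule LIMSEQ_le)
      show "(\<lambda>k. 2 * (\<integral>\<^sup>+x. ennreal (G k x) \<partial>M)) \<longlonglongrightarrow> 2 * (\<integral>\<^sup>+x. ennreal (h n x) \<partial>M)"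
        by (intro ennreal_tendsto_cmult lim1) auto
      show "(\<lambda>k. (\<integral>\<^sup>+x. ennreal ((G k x)\<^sup>2) \<partial>lborel) + ennreal C) \<longlonglongrightarrow> (\<integral>\<^sup>+x. ennreal ((h n x)\<^sup>2) \<partial>lborel) + ennreal C"
        by (intro tendsto_intros lim2)
      show "\<exists>K. \<forall>k\<ge>K. 2 * (\<integral>\<^sup>+x. ennreal (G k x) \<partial>M) \<le> (\<integral>\<^sup>+x. ennreal ((G k x)\<^sup>2) \<partial>lborel) + ennreal C"
        using char_square_test_function_bound[OF int G, of 1] by (intro exI[of _ 0]) (simp add: C_def)
    qed
    moreover have "(\<integral>\<^sup>+x. ennreal ((h n x)\<^sup>2) \<partial>lborel) \<le> (\<integral>\<^sup>+x. ennreal (h n x) \<partial>M)"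
    proof -
      have "(\<integral>\<^sup>+x. ennreal (h n x) \<partial>M) = (\<integral>\<^sup>+x. ennreal (f x) * ennreal (h n x) \<partial>lborel)"
        by (subst M) (subst nn_integral_density; simp)
      moreover have "ennreal ((h n x)\<^sup>2) \<le> ennreal (f x) * ennreal (h n x)" for x
        using h0[of n x] f(3)[of x]
        by (auto simp: power2_eq_square ennreal_mult[symmetric] intro!: ennreal_leI mult_right_mono)
      ultimately show ?thesis by (simp add: nn_integral_mono)
    qed
    moreover have "(\<integral>\<^sup>+x. ennreal ((h n x)\<^sup>2) \<partial>lborel) < \<infinity>"
    proof -
      have "(\<integral>\<^sup>+x. ennreal ((h n x)\<^sup>2) \<partial>lborel) \<le> (\<integral>\<^sup>+x. ennreal ((real n)\<^sup>2) * indicator {- real n..real n} x \<partial>lborel)"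
      proof (rule nn_integral_mono)
        fix x
        show "ennreal ((h n x)\<^sup>2) \<le> ennreal ((real n)\<^sup>2) * indicator {- real n..real n} x"
          using h0(1,2)[of n x]
          by (cases "x \<in> {- real n..real n}") (auto simp: h_def[of n x] intro!: ennreal_leI power_mono)
      qed
      also have "\<dots> < \<infinity>"
        by (subst nn_integral_cmult) (auto simp: ennreal_mult_less_top)
      finally show ?thesis .
    qed
    ultimately have "2 * (\<integral>\<^sup>+x. ennreal ((h n x)\<^sup>2) \<partial>lborel) \<le> (\<integral>\<^sup>+x. ennreal ((h n x)\<^sup>2) \<partial>lborel) + ennreal C"
      by (meson mult_left_mono order_trans zero_le)
    then have "(\<integral>\<^sup>+x. ennreal ((h n x)\<^sup>2) \<partial>lborel) + (\<integral>\<^sup>+x. ennreal ((h n x)\<^sup>2) \<partial>lborel)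
        \<le> (\<integral>\<^sup>+x. ennreal ((h n x)\<^sup>2) \<partial>lborel) + ennreal C"
      by (simp add: mult_2)
    then show ?thesis
      using \<open>(\<integral>\<^sup>+x. ennreal ((h n x)\<^sup>2) \<partial>lborel) < \<infinity>\<close>
      by (subst (asm) ennreal_add_left_cancel_le) auto
  qed
  have "(\<lambda>n. \<integral>\<^sup>+x. ennreal ((h n x)\<^sup>2) \<partial>lborel) \<longlonglongrightarrow> (\<integral>\<^sup>+x. ennreal ((f x)\<^sup>2) \<partial>lborel)"
  proof (rule nn_integral_LIMSEQ)
    show "incseq (\<lambda>n x. ennreal ((h n x)\<^sup>2))"
      unfolding incseq_def le_fun_def
    proof (intro allI impI ennreal_leI power_mono h0)
      fix m n :: nat and x assume "m \<le> n"
      then show "h m x \<le> h n x"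
        unfolding h_def using f(3)[of x] by (intro mult_mono) (auto simp: indicator_def)
    qed
    fix x
    obtain k where k: "max \<bar>x\<bar> (f x) < real k" using reals_Archimedean2 by blast
    have "h n x = f x" if "n \<ge> k" for n
      using k that by (auto simp: h_def indicator_def)
    then have "(\<lambda>n. h n x) \<longlonglongrightarrow> f x"
      by (intro tendsto_eventually) (auto simp: eventually_sequentially)
    then show "(\<lambda>n. ennreal ((h n x)\<^sup>2)) \<longlonglongrightarrow> ennreal ((f x)\<^sup>2)"
      by (intro tendsto_ennrealI tendsto_intros)
  qed auto
  then have "(\<integral>\<^sup>+x. ennreal ((f x)\<^sup>2) \<partial>lborel) \<le> ennreal C"
    by (rule LIMSEQ_le_const2) (use trunc in auto)
  then have "(\<integral>\<^sup>+x. ennreal ((f x)\<^sup>2) \<partial>lborel) < \<infinity>"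
    using ennreal_less_top le_less_trans by fastforce
  then have "integrable lborel (\<lambda>x. (f x)\<^sup>2)"
    by (intro integrableI_nonneg) auto
  then show ?thesis
    by (rule that[OF \<open>f \<in> borel_measurable borel\<close> f(3) M])
qed

text \<open>The density is the inverse Fourier integral of the transform. Nonnegativity is not visible
in that formula; it comes from writing the density as the pointwise limit of the smoothed densities, which
also identifies it: their integrals against a test function converge both to the integral with respect to
\<open>M\<close> and to that against the limit.\<close>
theorem char_integrable_imp_continuous_density:
  assumes int: "integrable lborel (char M)"
  obtains f where "continuous_on UNIV f" "\<And>x. 0 \<le> f x" "M = density lborel (\<lambda>x. ennreal (f x))"
proof -
  define F where "F x = 1 / (2 * pi) * (CLINT t|lborel. iexp (- (t * x)) * char M t)" for x
  define B where "B = 1 / (2 * pi) * (\<integral>t. cmod (char M t) \<partial>lborel)"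
  have intn: "integrable lborel (\<lambda>t. cmod (char M t))"
    using int by (rule integrable_norm)
  have contF: "continuous_on UNIV F"
  proof (rule continuous_at_imp_continuous_on, intro ballI)
    fix x
    show "isCont F x"
      unfolding continuous_at_sequentially
    proof safe
      fix X assume X: "X \<longlonglongrightarrow> x"
      have "(\<lambda>n. CLINT t|lborel. iexp (- (t * X n)) * char M t) \<longlonglongrightarrow> (CLINT t|lborel. iexp (- (t * x)) * char M t)"
        by (rule integral_dominated_convergence[where w = "\<lambda>t. cmod (char M t)"])
           (auto intro!: tendsto_intros X simp: norm_mult intn)
      then show "(F \<circ> X) \<longlonglongrightarrow> F x"
        unfolding comp_def F_def by (intro tendsto_intros)
    qed
  qed
  have lim: "(\<lambda>n. smoothing (inverse (Suc n)) x) \<longlonglongrightarrow> Re (F x)" for x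
  proof -
    have "(\<lambda>n. CLINT t|lborel. iexp (- (t * x)) * char M t * complex_of_real (exp (- ((inverse (Suc n) * t)\<^sup>2) / 2)))
      \<longlonglongrightarrow> (CLINT t|lborel. iexp (- (t * x)) * char M t)"
    proof (rule integral_dominated_convergence[where w = "\<lambda>t. cmod (char M t)"])
      have "(\<lambda>n. iexp (- (t * x)) * char M t * complex_of_real (exp (- ((inverse (real (Suc n)) * t)\<^sup>2) / 2)))
          \<longlonglongrightarrow> iexp (- (t * x)) * char M t * complex_of_real (exp (- ((0 * t)\<^sup>2) / 2))" for t
        by (intro tendsto_intros LIMSEQ_inverse_real_of_nat) simp
      then show "AE t in lborel. (\<lambda>n. iexp (- (t * x)) * char M t * complex_of_real (exp (- ((inverse (real (Suc n)) * t)\<^sup>2) / 2)))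
          \<longlonglongrightarrow> iexp (- (t * x)) * char M t"
        by simp
      show "AE t in lborel. norm (iexp (- (t * x)) * char M t * complex_of_real (exp (- ((inverse (real (Suc n)) * t)\<^sup>2) / 2)))
         \<le> cmod (char M t)" for n
        by (auto simp: norm_mult mult_left_le)
    qed (auto simp: intn)
    then have "(\<lambda>n. complex_of_real (smoothing (inverse (Suc n)) x)) \<longlonglongrightarrow> F x"
      unfolding F_def smoothing_def
      by (subst gaussian_smoothing_fourier) (auto intro!: tendsto_intros)
    from tendsto_Re[OF this] show ?thesis by simp
  qed
  have bound: "smoothing s x \<le> B" if "0 < s" for s x
  proof -
    have "smoothing s x = cmod (complex_of_real (smoothing s x))"
      by (simp add: smoothing_nonneg)
    also have "\<dots> = 1 / (2 * pi) * cmod (CLINT t|lborel. iexp (- (t * x)) * char M t * complex_of_real (exp (- ((s * t)\<^sup>2) / 2)))"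
      unfolding smoothing_def gaussian_smoothing_fourier[OF that] by (simp add: norm_mult norm_divide)
    also have "\<dots> \<le> B"
      unfolding B_def
    proof (intro mult_left_mono order_trans[OF integral_norm_bound] integral_mono'[OF intn])
      fix t show "norm (iexp (- (t * x)) * char M t * complex_of_real (exp (- ((s * t)\<^sup>2) / 2))) \<le> cmod (char M t)"
        by (auto simp: norm_mult mult_left_le)
    qed auto
    finally show ?thesis .
  qed
  have contf: "continuous_on UNIV (\<lambda>x. Re (F x))"
    by (intro continuous_intros contF)
  then have [measurable]: "(\<lambda>x. Re (F x)) \<in> borel_measurable borel"
    by (rule borel_measurable_continuous_onI)
  have "M = density lborel (\<lambda>x. ennreal (Re (F x)))"
  proof (rule finite_measure_eqI_test_functions)
    fix g :: "real \<Rightarrow> real" and R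
    assume g: "continuous_on UNIV g" "\<And>x. 0 \<le> g x" "\<And>x. g x \<le> 1" "\<And>x. x \<notin> {-R..R} \<Longrightarrow> g x = 0"
    have [measurable]: "g \<in> borel_measurable borel"
      using g(1) by (rule borel_measurable_continuous_onI)
    have "(\<lambda>n. \<integral>\<^sup>+x. ennreal (g x) * ennreal (smoothing (inverse (Suc n)) x) \<partial>lborel)
        \<longlonglongrightarrow> (\<integral>\<^sup>+x. ennreal (g x) * ennreal (Re (F x)) \<partial>lborel)"
    proof (rule nn_integral_dominated_convergence[where w = "\<lambda>x. ennreal B * indicator {-R..R} x"])
      show "(\<integral>\<^sup>+x. ennreal B * indicator {-R..R} x \<partial>lborel) < \<infinity>"
        by (subst nn_integral_cmult) (auto simp: ennreal_mult_less_top emeasure_lborel_Icc_eq)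
      show "AE x in lborel. ennreal (g x) * ennreal (smoothing (inverse (Suc n)) x) \<le> ennreal B * indicator {-R..R} x" for n
      proof (rule AE_I2)
        fix x
        have "ennreal (g x) * ennreal (smoothing (inverse (Suc n)) x) \<le> 1 * ennreal B"
          using g(3)[of x] bound[of "inverse (Suc n)" x]
          by (intro mult_mono) (auto intro: ennreal_leI)
        then show "ennreal (g x) * ennreal (smoothing (inverse (Suc n)) x) \<le> ennreal B * indicator {-R..R} x"
          using g(4)[of x] by (cases "x \<in> {-R..R}") auto
      qed
      show "AE x in lborel. (\<lambda>n. ennreal (g x) * ennreal (smoothing (inverse (Suc n)) x)) \<longlonglongrightarrow> ennreal (g x) * ennreal (Re (F x))"
        by (intro AE_I2 ennreal_tendsto_cmult tendsto_ennrealI lim) auto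
    qed auto
    from LIMSEQ_unique[OF smoothing_weak_limit[OF g(1,2,3)] this]
    have "(\<integral>\<^sup>+x. ennreal (g x) \<partial>M) = (\<integral>\<^sup>+x. ennreal (g x) * ennreal (Re (F x)) \<partial>lborel)" .
    then show "(\<integral>\<^sup>+x. ennreal (g x) \<partial>M) = (\<integral>\<^sup>+x. ennreal (g x) \<partial>density lborel (\<lambda>x. ennreal (Re (F x))))"
      by (subst nn_integral_density) (auto simp: mult.commute)
  qed (auto simp: finite_measure_axioms)
  moreover have "0 \<le> Re (F x)" for x
    using lim[of x] by (rule LIMSEQ_le_const) (auto simp: smoothing_nonneg)
  ultimately show ?thesis
    using that contf by blast
qed

end

section \<open>The refinement equation of an invariant measure\<close>

lemma borel_prob_on_interval_imp_real_distribution: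
  "borel_prob_on_interval \<nu> \<Longrightarrow> real_distribution \<nu>"
  unfolding borel_prob_on_interval_def
  by (simp add: real_distribution_def real_distribution_axioms_def)

lemma set_integral_borel_prob_on_interval:
  fixes f :: "real \<Rightarrow> real"
  assumes \<nu>: "borel_prob_on_interval \<nu>" and [measurable]: "f \<in> borel_measurable borel"
  shows "(LINT x:{-1..1}|\<nu>. f x) = (LINT x|\<nu>. f x)"
  unfolding set_lebesgue_integral_def
proof (rule integral_cong_AE)
  have [measurable_cong]: "sets \<nu> = sets borel"
    using \<nu> by (simp add: borel_prob_on_interval_def)
  show "(\<lambda>x. indicator {-1..1} x *\<^sub>R f x) \<in> borel_measurable \<nu>" "f \<in> borel_measurable \<nu>"
    by measurable
  have "- {-1..1} \<in> null_sets \<nu>"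
    using \<nu> by (auto simp: borel_prob_on_interval_def null_sets_def)
  then show "AE x in \<nu>. indicator {-1..1} x *\<^sub>R f x = f x"
    by (rule AE_mp[OF AE_not_in]) (auto simp: indicator_def)
qed

text \<open>A point distributed according to \<open>\<mu>\<close> has the law of \<open>\<delta> x + (1 - \<delta>) \<beta>\<close> with independent \<open>x\<close> and \<open>\<beta>\<close>
distributed according to \<open>\<mu>\<close> and \<open>\<sigma>\<close>, and the exponential turns the sum into a product. As the
transfer operator acts on real functions, invariance is applied to the real and to the imaginary part of
the exponential.\<close>
lemma char_invariant_measure:
  assumes \<sigma>: "borel_prob_on_interval \<sigma>" and inv: "invariant_measure \<delta> \<sigma> \<mu>"
  shows "char \<mu> y = char \<mu> (\<delta> * y) * char \<sigma> ((1 - \<delta>) * y)"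
proof -
  have \<mu>: "borel_prob_on_interval \<mu>" using inv by (simp add: invariant_measure_def)
  interpret S: real_distribution \<sigma> using \<sigma> by (rule borel_prob_on_interval_imp_real_distribution)
  interpret R: real_distribution \<mu> using \<mu> by (rule borel_prob_on_interval_imp_real_distribution)
  define H where "H x = iexp (\<delta> * y * x) * char \<sigma> ((1 - \<delta>) * y)" for x
  have H_eq: "H x = (CLINT \<beta>|\<sigma>. iexp (y * ifs_map \<delta> \<beta> x))" for x
  proof -
    have "iexp (y * ifs_map \<delta> \<beta> x) = iexp (\<delta> * y * x) * iexp ((1 - \<delta>) * y * \<beta>)" for \<beta>
      by (simp add: ifs_map_def algebra_simps flip: exp_add)
    then show ?thesis
      unfolding H_def char_def by (simp only: integral_mult_right_zero)
  qed
  have int_iexp: "integrable \<sigma> (\<lambda>\<beta>. iexp (y * ifs_map \<delta> \<beta> x))" for x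
    unfolding ifs_map_def by (intro S.integrable_const_bound[where B = 1]) (auto simp del: of_real_mult)
  have int_H: "integrable \<mu> H"
    unfolding H_def by (intro integrable_mult_left R.integrable_const_bound[where B = 1]) (auto simp del: of_real_mult)
  \<comment> \<open>\<open>T\<close> stands for the real or the imaginary part\<close>
  have real_part: "(LINT x|\<mu>. T (iexp (y * x))) = (LINT x|\<mu>. T (H x))"
    if T: "bounded_linear T" for T :: "complex \<Rightarrow> real"
  proof -
    have contT: "continuous_on UNIV T"
      using T by (rule bounded_linear.continuous_on[OF _ continuous_on_id])
    have cont: "continuous_on UNIV (\<lambda>x. T (iexp (y * x)))"
      by (intro continuous_on_compose2[OF contT] continuous_intros) auto
    then have [measurable]: "(\<lambda>x. T (iexp (y * x))) \<in> borel_measurable borel"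
      by (rule borel_measurable_continuous_onI)
    have [measurable]: "T \<in> borel_measurable borel"
      using contT by (rule borel_measurable_continuous_onI)
    have op: "transfer_op \<delta> \<sigma> (\<lambda>x. T (iexp (y * x))) x = T (H x)" for x
    proof -
      have [measurable]: "(\<lambda>\<beta>. T (iexp (y * ifs_map \<delta> \<beta> x))) \<in> borel_measurable borel"
        unfolding ifs_map_def by measurable
      have "transfer_op \<delta> \<sigma> (\<lambda>x. T (iexp (y * x))) x = (LINT \<beta>|\<sigma>. T (iexp (y * ifs_map \<delta> \<beta> x)))"
        unfolding transfer_op_def by (rule set_integral_borel_prob_on_interval[OF \<sigma>]) measurable
      also have "\<dots> = T (H x)"
        unfolding H_eq by (rule integral_bounded_linear[OF T int_iexp])
      finally show ?thesis .
    qed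
    have "(LINT x|\<mu>. T (iexp (y * x))) = (LINT x:{-1..1}|\<mu>. T (iexp (y * x)))"
      by (rule set_integral_borel_prob_on_interval[OF \<mu>, symmetric]) measurable
    also have "\<dots> = (LINT x:{-1..1}|\<mu>. transfer_op \<delta> \<sigma> (\<lambda>x. T (iexp (y * x))) x)"
      using inv continuous_on_subset[OF cont] by (auto simp: invariant_measure_def transfer_adjoint_def)
    also have "\<dots> = (LINT x:{-1..1}|\<mu>. T (H x))"
      by (simp only: op)
    also have "\<dots> = (LINT x|\<mu>. T (H x))"
      unfolding H_def by (rule set_integral_borel_prob_on_interval[OF \<mu>]) measurable
    finally show ?thesis .
  qed
  have int_iexp': "integrable \<mu> (\<lambda>x. iexp (y * x))"
    by (intro R.integrable_const_bound[where B = 1]) (auto simp del: of_real_mult)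
  have "char \<mu> y = (CLINT x|\<mu>. H x)"
  proof (rule complex_eqI)
    show "Re (char \<mu> y) = Re (CLINT x|\<mu>. H x)"
      unfolding char_def integral_bounded_linear[OF bounded_linear_Re int_iexp', symmetric]
        integral_bounded_linear[OF bounded_linear_Re int_H, symmetric]
      by (rule real_part[OF bounded_linear_Re])
    show "Im (char \<mu> y) = Im (CLINT x|\<mu>. H x)"
      unfolding char_def integral_bounded_linear[OF bounded_linear_Im int_iexp', symmetric]
        integral_bounded_linear[OF bounded_linear_Im int_H, symmetric]
      by (rule real_part[OF bounded_linear_Im])
  qed
  also have "\<dots> = char \<mu> (\<delta> * y) * char \<sigma> ((1 - \<delta>) * y)"
    unfolding H_def char_def[of \<mu>] by (rule integral_mult_left_zero)
  finally show ?thesis .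
qed

section \<open>Decay of the transform of a twice iterated system\<close>

text \<open>Each of the \<open>n\<close> steps of the refinement of \<open>\<omega>\<close> contributes a value of \<open>\<psi>\<close> at a point
\<open>(1 - \<delta>) t / \<delta> ^ k\<close> with \<open>k \<ge> 1\<close>. The first refinement of \<open>\<psi>\<close> above \<open>(1 - \<delta>) t\<close> already brings in the
factor of \<open>\<phi>\<close> that makes this value at most \<open>q\<close>, and further refinements only decrease it.\<close>
lemma two_step_refinement_geometric_decay:
  fixes \<phi> \<psi> \<omega> :: "real \<Rightarrow> complex"
  assumes "0 < \<delta>"
    and le1: "\<And>y. cmod (\<phi> y) \<le> 1" "\<And>y. cmod (\<omega> y) \<le> 1"
    and \<psi>: "\<And>y. \<psi> y = \<psi> (\<delta> * y) * \<phi> ((1 - \<delta>) * y)"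
    and \<omega>: "\<And>y. \<omega> y = \<omega> (\<delta> * y) * \<psi> ((1 - \<delta>) * y)"
    and t: "cmod (\<phi> (inverse \<delta> * (1 - \<delta>)\<^sup>2 * t)) * cmod (\<psi> ((1 - \<delta>) * t)) \<le> q"
  shows "cmod (\<omega> (t / \<delta> ^ n)) \<le> q ^ n"
proof -
  have "0 \<le> q"
    using t by (meson mult_nonneg_nonneg norm_ge_zero order_trans)
  have level1: "cmod (\<psi> ((1 - \<delta>) * (t / \<delta> ^ Suc k))) \<le> q" for k
  proof (induction k)
    case 0
    have "\<psi> ((1 - \<delta>) * (t / \<delta> ^ Suc 0)) = \<psi> ((1 - \<delta>) * t) * \<phi> (inverse \<delta> * (1 - \<delta>)\<^sup>2 * t)"
    proof -
      have "\<delta> * ((1 - \<delta>) * (t / \<delta> ^ Suc 0)) = (1 - \<delta>) * t"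
        "(1 - \<delta>) * ((1 - \<delta>) * (t / \<delta> ^ Suc 0)) = inverse \<delta> * (1 - \<delta>)\<^sup>2 * t"
        using \<open>0 < \<delta>\<close> by (simp_all add: divide_inverse power2_eq_square)
      then show ?thesis
        using \<psi>[of "(1 - \<delta>) * (t / \<delta> ^ Suc 0)"] by (simp only:)
    qed
    then show ?case
      using t by (simp only: norm_mult mult.commute)
  next
    case (Suc k)
    have "\<psi> ((1 - \<delta>) * (t / \<delta> ^ Suc (Suc k))) =
        \<psi> ((1 - \<delta>) * (t / \<delta> ^ Suc k)) * \<phi> ((1 - \<delta>) * ((1 - \<delta>) * (t / \<delta> ^ Suc (Suc k))))"
      using \<open>0 < \<delta>\<close> by (subst \<psi>) simp
    then have "cmod (\<psi> ((1 - \<delta>) * (t / \<delta> ^ Suc (Suc k)))) \<le> cmod (\<psi> ((1 - \<delta>) * (t / \<delta> ^ Suc k)))"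
      using le1(1) by (simp only: norm_mult) (simp add: mult_left_le)
    with Suc show ?case by simp
  qed
  show ?thesis
  proof (induction n)
    case 0
    then show ?case using le1 by simp
  next
    case (Suc n)
    have "\<omega> (t / \<delta> ^ Suc n) = \<omega> (t / \<delta> ^ n) * \<psi> ((1 - \<delta>) * (t / \<delta> ^ Suc n))"
      using \<open>0 < \<delta>\<close> by (subst \<omega>) simp
    then have "cmod (\<omega> (t / \<delta> ^ Suc n)) \<le> q ^ n * q"
      using Suc level1 \<open>0 \<le> q\<close> by (simp only: norm_mult) (intro mult_mono, auto)
    then show ?case by (simp add: mult.commute)
  qed
qed

text \<open>The scale of \<open>y\<close> is \<open>n = \<lfloor>ln y / ln (1 / \<delta>)\<rfloor>\<close>; the factor \<open>exp a\<close> pays for the rounding.\<close>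
lemma geometric_decay_imp_power_decay:
  fixes u :: "real \<Rightarrow> real"
  assumes \<delta>: "0 < \<delta>" "\<delta> < 1" and a: "0 \<le> a"
    and u: "\<And>t n. t \<in> {1..inverse \<delta>} \<Longrightarrow> u (t / \<delta> ^ n) \<le> exp (- a) ^ n"
    and y: "1 \<le> y"
  shows "u y \<le> exp a * y powr (- a / ln (inverse \<delta>))"
proof -
  define L where "L = ln (inverse \<delta>)"
  have L: "0 < L" using \<delta> by (simp add: L_def one_less_inverse)
  define n where "n = nat \<lfloor>ln y / L\<rfloor>"
  have n: "real n \<le> ln y / L" "ln y / L < real n + 1"
    using y L by (auto simp: n_def)
  have pow: "\<delta> ^ n = exp (- (real n * L))"
    using \<delta> by (simp add: L_def ln_inverse exp_of_nat_mult)
  have "y * \<delta> ^ n = exp (ln y - real n * L)"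
    unfolding pow using y by (simp add: exp_diff exp_minus field_simps)
  moreover have "inverse \<delta> = exp L" using \<delta> by (simp add: L_def)
  ultimately have "y * \<delta> ^ n \<in> {1..inverse \<delta>}"
    using n L by (auto simp: field_simps)
  from u[OF this, of n] have "u y \<le> exp (- a) ^ n"
    using \<delta> by simp
  also have "\<dots> = exp (- (a * real n))"
    by (simp add: exp_of_nat_mult[symmetric] mult.commute)
  also have "\<dots> \<le> exp (a - a * (ln y / L))"
  proof -
    have "a * (ln y / L) \<le> a * (real n + 1)"
      using n a by (intro mult_left_mono) auto
    then show ?thesis by (simp add: algebra_simps)
  qed
  also have "\<dots> = exp a * y powr (- a / L)"
    using y by (simp add: powr_def exp_diff exp_minus field_simps)
  finally show ?thesis by (simp add: L_def)
qed

lemma power_decay_imp_integrable: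
  fixes u :: "real \<Rightarrow> real"
  assumes [measurable]: "u \<in> borel_measurable borel" and nn: "\<And>y. 0 \<le> u y" and le1: "\<And>y. u y \<le> 1"
    and even: "\<And>y. u (- y) = u y"
    and decay: "\<And>y. 1 \<le> y \<Longrightarrow> u y \<le> K * y powr e" and e: "e < -1"
  shows "integrable lborel u"
proof -
  have K: "0 \<le> K" using decay[of 1] nn[of 1] by simp
  define w where "w y = indicator {1..} y * y powr e" for y :: real
  have w0: "0 \<le> w y" for y by (simp add: w_def)
  have [measurable]: "w \<in> borel_measurable borel" unfolding w_def by measurable
  have "(\<lambda>y. y powr e) absolutely_integrable_on {1..}"
    using has_integral_powr_to_inf[OF e, of 1]
    by (intro nonnegative_absolutely_integrable_1) (auto simp: integrable_on_def)
  then have "integrable lebesgue w"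
    by (simp add: set_integrable_def w_def[abs_def])
  then have w: "integrable lborel w"
    by (subst (asm) integrable_completion) auto
  have w': "integrable lborel (\<lambda>y. w (0 + (-1) * y))"
    by (intro lborel_integrable_real_affine w) simp
  have one: "integrable lborel (indicator {-1..1::real} :: real \<Rightarrow> real)"
    by (intro integrable_real_indicator) auto
  have "integrable lborel (\<lambda>y. indicator {-1..1} y + K * (w y + w (0 + (-1) * y)))"
    by (intro Bochner_Integration.integrable_add integrable_mult_right one w w')
  then show ?thesis
  proof (rule Bochner_Integration.integrable_bound)
    show "AE y in lborel. norm (u y) \<le> norm (indicator {-1..1} y + K * (w y + w (0 + (-1) * y)))"
    proof (rule AE_I2)
      fix y :: real
      consider "\<bar>y\<bar> \<le> 1" | "1 < y" | "y < -1" by linarith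
      then have "u y \<le> indicator {-1..1} y + K * (w y + w (0 + (-1) * y))"
      proof cases
        case 1
        then have "(indicator {-1..1} y :: real) = 1" by (auto simp: indicator_def)
        moreover have "0 \<le> K * (w y + w (0 + (-1) * y))"
          using K w0 by (intro mult_nonneg_nonneg add_nonneg_nonneg)
        ultimately show ?thesis
          using le1[of y] by linarith
      next
        case 2
        then show ?thesis
          using decay[of y] by (simp add: w_def)
      next
        case 3
        then show ?thesis
          using decay[of "- y"] even[of y] by (simp add: w_def)
      qed
      then show "norm (u y) \<le> norm (indicator {-1..1} y + K * (w y + w (0 + (-1) * y)))"
        using nn[of y] by simp
    qed
  qed simp
qed

section \<open>Densities of the twice iterated invariant measure\<close>

lemma cmod_char_minus: "cmod (char M (- t)) = cmod (char M t)"
proof -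
  have "char M (- t) = cnj (char M t)"
    unfolding char_def by (simp add: exp_cnj flip: Bochner_Integration.integral_cnj)
  then show ?thesis by simp
qed

text \<open>Exponentiating is legitimate also where a transform vanishes: the sum of the logarithms is
\<open>-\<infinity>\<close> there, and the product is 0.\<close>
lemma log_fourier_add_le_imp_prod_le:
  assumes "log_fourier \<mu> x + log_fourier \<nu> y \<le> ereal c"
  shows "cmod (fourier \<mu> x) * cmod (fourier \<nu> y) \<le> exp c"
proof (cases "fourier \<mu> x = 0 \<or> fourier \<nu> y = 0")
  case True
  then show ?thesis by auto
next
  case False
  then have "ln (cmod (fourier \<mu> x) * cmod (fourier \<nu> y)) \<le> c"
    using assms by (simp add: log_fourier_def ln_mult)
  then have "exp (ln (cmod (fourier \<mu> x) * cmod (fourier \<nu> y))) \<le> exp c"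
    by simp
  also have "exp (ln (cmod (fourier \<mu> x) * cmod (fourier \<nu> y))) = cmod (fourier \<mu> x) * cmod (fourier \<nu> y)"
    using False by (intro exp_ln) simp
  finally show ?thesis .
qed

text \<open>For each \<open>t\<close> the two logarithms add up to at most \<open>- a\<close>, so the two-step refinement has geometric
ratio \<open>exp (- a)\<close>.\<close>
lemma sup_log_fourier_imp_power_decay:
  fixes \<delta> a :: real and \<mu>0 \<mu>1 \<mu>2 :: "real measure"
  assumes \<delta>: "0 < \<delta>" "\<delta> < 1"
    and \<mu>0: "borel_prob_on_interval \<mu>0"
    and \<mu>1: "invariant_measure \<delta> \<mu>0 \<mu>1"
    and \<mu>2: "invariant_measure \<delta> \<mu>1 \<mu>2"
    and a: "0 \<le> a"
      "ereal a \<le> - (SUP t\<in>{1..inverse \<delta>}.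
         log_fourier \<mu>0 (inverse \<delta> * (1 - \<delta>)\<^sup>2 * t) + log_fourier \<mu>1 ((1 - \<delta>) * t))"
    and y: "1 \<le> y"
  shows "cmod (char \<mu>2 y) \<le> exp a * y powr (- a / ln (inverse \<delta>))"
proof -
  have p: "borel_prob_on_interval \<mu>1" "borel_prob_on_interval \<mu>2"
    using \<mu>1 \<mu>2 by (auto simp: invariant_measure_def)
  have "cmod (fourier \<mu>2 y) \<le> exp a * y powr (- a / ln (inverse \<delta>))"
  proof (rule geometric_decay_imp_power_decay[OF \<delta> a(1) _ y])
    fix t n assume t: "t \<in> {1..inverse \<delta>}"
    show "cmod (fourier \<mu>2 (t / \<delta> ^ n)) \<le> exp (- a) ^ n"
    proof (rule two_step_refinement_geometric_decay[where \<phi> = "fourier \<mu>0" and \<psi> = "fourier \<mu>1", OF \<delta>(1)])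
      show "cmod (fourier \<mu>0 y) \<le> 1" "cmod (fourier \<mu>2 y) \<le> 1" for y
        unfolding fourier_def using \<mu>0 p
        by (auto intro: real_distribution.cmod_char_le_1 borel_prob_on_interval_imp_real_distribution)
      show "fourier \<mu>1 y = fourier \<mu>1 (\<delta> * y) * fourier \<mu>0 ((1 - \<delta>) * y)" for y
        using char_invariant_measure[OF \<mu>0 \<mu>1, of "- y"] by (simp add: fourier_def)
      show "fourier \<mu>2 y = fourier \<mu>2 (\<delta> * y) * fourier \<mu>1 ((1 - \<delta>) * y)" for y
        using char_invariant_measure[OF p(1) \<mu>2, of "- y"] by (simp add: fourier_def)
      have "log_fourier \<mu>0 (inverse \<delta> * (1 - \<delta>)\<^sup>2 * t) + log_fourier \<mu>1 ((1 - \<delta>) * t) \<le>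
        (SUP t\<in>{1..inverse \<delta>}. log_fourier \<mu>0 (inverse \<delta> * (1 - \<delta>)\<^sup>2 * t) + log_fourier \<mu>1 ((1 - \<delta>) * t))"
        using t by (rule SUP_upper)
      also have "\<dots> \<le> ereal (- a)"
        using a(2) by (subst (asm) ereal_minus_le_minus[symmetric]) simp
      finally show "cmod (fourier \<mu>0 (inverse \<delta> * (1 - \<delta>)\<^sup>2 * t)) * cmod (fourier \<mu>1 ((1 - \<delta>) * t)) \<le> exp (- a)"
        by (rule log_fourier_add_le_imp_prod_le)
    qed
  qed
  then show ?thesis
    by (simp add: fourier_def cmod_char_minus)
qed

text \<open>The cases \<open>p = 2\<close> and \<open>p = 1\<close> give the \<open>L\<^sup>2\<close> density and the continuous density. As the
threshold is exceeded strictly, there is a real \<open>a\<close> in between, and the decay exponent of the \<open>p\<close>-th power,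
which is \<open>- p a / ln (1 / \<delta>)\<close>, is less than \<open>-1\<close>.\<close>
lemma sup_log_fourier_imp_integrable_char_power:
  fixes \<delta> :: real and \<mu>0 \<mu>1 \<mu>2 :: "real measure" and p :: nat
  assumes \<delta>: "0 < \<delta>" "\<delta> < 1"
    and \<mu>0: "borel_prob_on_interval \<mu>0"
    and \<mu>1: "invariant_measure \<delta> \<mu>0 \<mu>1"
    and \<mu>2: "invariant_measure \<delta> \<mu>1 \<mu>2"
    and p: "0 < p"
    and \<eta>: "ereal (1 / p * ln (inverse \<delta>)) < - (SUP t\<in>{1..inverse \<delta>}.
         log_fourier \<mu>0 (inverse \<delta> * (1 - \<delta>)\<^sup>2 * t) + log_fourier \<mu>1 ((1 - \<delta>) * t))"
  shows "integrable lborel (\<lambda>t. cmod (char \<mu>2 t) ^ p)"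
proof -
  interpret real_distribution \<mu>2
    using \<mu>2 by (intro borel_prob_on_interval_imp_real_distribution) (simp add: invariant_measure_def)
  define L where "L = ln (inverse \<delta>)"
  have L: "0 < L" using \<delta> by (simp add: L_def one_less_inverse)
  obtain a where a: "ereal (1 / p * L) < ereal a" "ereal a < - (SUP t\<in>{1..inverse \<delta>}.
         log_fourier \<mu>0 (inverse \<delta> * (1 - \<delta>)\<^sup>2 * t) + log_fourier \<mu>1 ((1 - \<delta>) * t))"
    using ereal_dense2[OF \<eta>] unfolding L_def by blast
  have a1: "1 / p * L < a" using a(1) by simp
  have "0 \<le> a"
    using a1 L p by (smt (verit) divide_nonneg_nonneg mult_nonneg_nonneg of_nat_0_le_iff)
  show ?thesis
  proof (rule power_decay_imp_integrable[where K = "exp a ^ p" and e = "real p * (- a / L)"])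
    show "cmod (char \<mu>2 y) ^ p \<le> 1" for y
      by (intro power_le_one) (auto simp: cmod_char_le_1)
    show "cmod (char \<mu>2 y) ^ p \<le> exp a ^ p * y powr (real p * (- a / L))" if "1 \<le> y" for y
    proof -
      have "cmod (char \<mu>2 y) ^ p \<le> (exp a * y powr (- a / L)) ^ p"
        using sup_log_fourier_imp_power_decay[OF \<delta> \<mu>0 \<mu>1 \<mu>2 \<open>0 \<le> a\<close> less_imp_le[OF a(2)] that]
        by (intro power_mono) (simp_all add: L_def)
      also have "\<dots> = exp a ^ p * y powr (real p * (- a / L))"
        using that by (simp add: power_mult_distrib powr_power mult.commute)
      finally show ?thesis .
    qed
    show "real p * (- a / L) < -1"
      using a1 L p by (simp add: field_simps)
  qed (auto simp: cmod_char_minus)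
qed

theorem theorem3:
  fixes \<delta> :: real and \<mu>0 \<mu>1 \<mu>2 :: "real measure" and \<eta> :: ereal
  assumes "0 < \<delta>" and "\<delta> < 1"
    and "borel_prob_on_interval \<mu>0"
    and "invariant_measure \<delta> \<mu>0 \<mu>1"
    and "invariant_measure \<delta> \<mu>1 \<mu>2"
    and "\<eta> = - (SUP t\<in>{1..inverse \<delta>}.
                 log_fourier \<mu>0 (inverse \<delta> * (1 - \<delta>)\<^sup>2 * t) + log_fourier \<mu>1 ((1 - \<delta>) * t))"
  shows "(\<eta> > ereal (1 / 2 * ln (inverse \<delta>)) \<longrightarrow>
            absolutely_continuous lborel \<mu>2 \<and>
            (\<exists>f. lebesgue_density \<mu>2 f \<and> integrable lborel (\<lambda>x. (f x)\<^sup>2)))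
       \<and> (\<eta> > ereal (ln (inverse \<delta>)) \<longrightarrow>
            (\<exists>f. lebesgue_density \<mu>2 f \<and> continuous_on UNIV f))"
proof -
  interpret real_distribution \<mu>2
    using assms(5) by (intro borel_prob_on_interval_imp_real_distribution) (simp add: invariant_measure_def)
  note int = sup_log_fourier_imp_integrable_char_power[OF assms(1-5), folded assms(6)]
  show ?thesis
  proof (intro conjI impI)
    assume "\<eta> > ereal (1 / 2 * ln (inverse \<delta>))"
    then have sq: "integrable lborel (\<lambda>t. (cmod (char \<mu>2 t))\<^sup>2)"
      using int[of 2] by simp
    show "absolutely_continuous lborel \<mu>2"
      by (rule char_square_integrable_imp_absolutely_continuous[OF sq])
    show "\<exists>f. lebesgue_density \<mu>2 f \<and> integrable lborel (\<lambda>x. (f x)\<^sup>2)"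
      using char_square_integrable_imp_L2_density[OF sq] unfolding lebesgue_density_def by metis
  next
    assume "\<eta> > ereal (ln (inverse \<delta>))"
    then have "integrable lborel (\<lambda>t. cmod (char \<mu>2 t))"
      using int[of 1] by simp
    then have "integrable lborel (char \<mu>2)"
      by (subst (asm) integrable_norm_iff) auto
    then obtain f where f: "continuous_on UNIV f" "\<And>x. 0 \<le> f x" "\<mu>2 = density lborel (\<lambda>x. ennreal (f x))"
      using char_integrable_imp_continuous_density by blast
    then show "\<exists>f. lebesgue_density \<mu>2 f \<and> continuous_on UNIV f"
      unfolding lebesgue_density_def using borel_measurable_continuous_onI[OF f(1)] by blast
  qed
qed

end
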